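(* Let $0<\alpha\le 1$. Then the function $(\theta_1,\theta_2)\mapsto D_{\mathrm{KL}}(p_{\theta_1}:p_{\theta_2})^\alpha$ is a metric on $\mathbb{H}$ if and only if $0<\alpha\le 1/2$.
   Context: $\mathbb{H}=\{z\in\mathbb{C}:\operatorname{Im}z>0\}$. For $\theta\in\mathbb{H}$, $p_\theta(x)=\frac{\operatorname{Im}\theta}{\pi|x-\theta|^2}$, $x\in\mathbb{R}$, is the Cauchy density with location $\operatorname{Re}\theta$ and scale $\operatorname{Im}\theta$. The Kullback–Leibler divergence is $D_{\mathrm{KL}}(p:q)=\int_{\mathbb{R}}p(x)\log\frac{p(x)}{q(x)}\,dx$. *)

theory Defs
  imports "HOL-Probability.Probability"
begin

definition upper_half_plane :: "complex set" where
  "upper_half_plane = {z. 0 < Im z}"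

definition cauchy_density :: "complex \<Rightarrow> real \<Rightarrow> real" where
  "cauchy_density \<theta> x = Im \<theta> / (pi * (cmod (complex_of_real x - \<theta>))\<^sup>2)"

(* A Bochner integral is 0 on non-integrable functions.  This default is irrelevant for two
   Cauchy densities with parameters in the upper half-plane: their ratio is bounded above and
   bounded away from 0, so the integrand is integrable. *)
definition KL_div :: "(real \<Rightarrow> real) \<Rightarrow> (real \<Rightarrow> real) \<Rightarrow> real" where
  "KL_div p q = (\<integral>x. p x * ln (p x / q x) \<partial>lborel)"

(* KL_divergence takes its two measures in the opposite order. *)
lemma KL_div_eq_KL_divergence:
  assumes "p \<in> borel_measurable borel" "q \<in> borel_measurable borel"
    and "\<And>x. 0 \<le> p x" "\<And>x. 0 < q x"
  shows "KL_div p q = KL_divergence (exp 1) (density lborel q) (density lborel p)"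
proof -
  have "KL_divergence (exp 1) (density lborel q) (density lborel p) =
      (\<integral>x. p x * log (exp 1) (p x / q x) \<partial>lborel)"
  proof (rule lborel.KL_density_density)
    show "AE x in lborel. q x = 0 \<longrightarrow> p x = 0"
      using assms(4) by (auto simp: less_le)
  qed (use assms in \<open>auto intro: less_imp_le\<close>)
  then show ?thesis
    by (simp add: KL_div_def log_def)
qed

(* Metric_space constrains d outside the carrier as well (nonnegativity and symmetry are
   unconditional there), so d is extended by 0; metric_on_iff shows that only the values
   of d on X matter. *)
definition metric_on :: "'a set \<Rightarrow> ('a \<Rightarrow> 'a \<Rightarrow> real) \<Rightarrow> bool" where
  "metric_on X d \<longleftrightarrow> Metric_space X (\<lambda>x y. if x \<in> X \<and> y \<in> X then d x y else 0)"

lemma metric_on_iff: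
  "metric_on X d \<longleftrightarrow>
    (\<forall>x\<in>X. \<forall>y\<in>X. 0 \<le> d x y) \<and>
    (\<forall>x\<in>X. \<forall>y\<in>X. d x y = 0 \<longleftrightarrow> x = y) \<and>
    (\<forall>x\<in>X. \<forall>y\<in>X. d x y = d y x) \<and>
    (\<forall>x\<in>X. \<forall>y\<in>X. \<forall>z\<in>X. d x z \<le> d x y + d y z)"
  unfolding metric_on_def Metric_space_def by auto

end

(* The substitution x = Re z + Im z * tan ((t - pi) / 2) turns the density of z into the uniform density on
   the circle and the density ratio into a constant multiple of |B - A e^(it)|^2 with
   A = cnj (z - w), B = z - cnj w and |A| < |B|.  The mean value property of ln |B - A u| then
   gives KL = ln (|z - cnj w|^2 / (4 Im z Im w)) = 2 ln (cosh R), where 2R is the hyperbolic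
   distance of z and w.

   The function ln (cosh t) / t^2 is decreasing with limit 1/2 at 0.  Monotonicity makes
   (2 ln (cosh R))^alpha subadditive in R for alpha <= 1/2.  For the converse, the triangle
   inequality for equidistant points on a geodesic says that
   (ln (cosh 2t) / ln (cosh t))^alpha <= 2, and the quotient tends to 4 as t tends to 0. *)
theory Submission
  imports Defs "HOL-Complex_Analysis.Complex_Analysis" "HOL-Real_Asymp.Real_Asymp"
begin

section \<open>Subadditivity of powers of \<open>ln (cosh t)\<close>\<close>

text \<open>This is the monotonicity of \<open>ln (cosh t) / t^2\<close> in a form free of division.
  Both sides agree at 0, so derivatives are compared; clearing denominators leaves the sign of
  \<open>k\<close>, which also vanishes at 0 and is settled by a second differentiation.\<close>

lemma ln_cosh_scale:
  fixes c t :: real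
  assumes "0 \<le> c" "c \<le> 1" "0 \<le> t"
  shows "c\<^sup>2 * ln (cosh t) \<le> ln (cosh (c * t))"
proof -
  define k where "k = (\<lambda>x::real. sinh (c * x) * cosh x - c * (sinh x * cosh (c * x)))"
  have k_nonneg: "0 \<le> k x" if "0 \<le> x" for x
  proof -
    have "k 0 \<le> k x"
    proof (rule DERIV_nonneg_imp_nondecreasing[OF that])
      fix u :: real assume "0 \<le> u" "u \<le> x"
      have "(k has_real_derivative (1 - c\<^sup>2) * (sinh (c * u) * sinh u)) (at u)"
        unfolding k_def
        by (auto intro!: derivative_eq_intros simp: algebra_simps power2_eq_square)
      moreover have "0 \<le> (1 - c\<^sup>2) * (sinh (c * u) * sinh u)"
        using assms \<open>0 \<le> u\<close> by (intro mult_nonneg_nonneg) (auto simp: power_le_one)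
      ultimately show "\<exists>y. (k has_real_derivative y) (at u) \<and> 0 \<le> y" by blast
    qed
    then show ?thesis by (simp add: k_def)
  qed
  define m where "m = (\<lambda>x::real. ln (cosh (c * x)) - c\<^sup>2 * ln (cosh x))"
  have "m 0 \<le> m t"
  proof (rule DERIV_nonneg_imp_nondecreasing[OF assms(3)])
    fix u :: real assume u: "0 \<le> u" "u \<le> t"
    have "(m has_real_derivative c * k u / (cosh (c * u) * cosh u)) (at u)"
      unfolding m_def k_def
      by (auto intro!: derivative_eq_intros simp: field_simps power2_eq_square)
    moreover have "0 \<le> c * k u / (cosh (c * u) * cosh u)"
      using assms k_nonneg u by (intro divide_nonneg_nonneg mult_nonneg_nonneg) auto
    ultimately show "\<exists>y. (m has_real_derivative y) (at u) \<and> 0 \<le> y" by blast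
  qed
  then show ?thesis by (simp add: m_def)
qed

text \<open>The scaling inequality \<open>c * G x \<le> G (c * x)\<close> for \<open>c\<close> in
  [0, 1] suffices: apply it at \<open>s + t\<close> with the weights \<open>s / (s + t)\<close> and
  \<open>t / (s + t)\<close>, which sum to 1, and add.\<close>

lemma powr_ln_cosh_subadditive:
  fixes s t \<alpha> :: real
  assumes "0 < \<alpha>" "\<alpha> \<le> 1/2" "0 \<le> s" "0 \<le> t"
  shows "(2 * ln (cosh (s + t))) powr \<alpha>
    \<le> (2 * ln (cosh s)) powr \<alpha> + (2 * ln (cosh t)) powr \<alpha>"
proof (cases "s + t = 0")
  case True
  then show ?thesis using assms by (simp add: add_nonneg_eq_0_iff)
next
  case False
  define G where "G = (\<lambda>x::real. (2 * ln (cosh x)) powr \<alpha>)"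
  have scale: "c * G x \<le> G (c * x)" if "0 \<le> c" "c \<le> 1" "0 \<le> x" for c x
  proof -
    \<comment> \<open>Here \<open>\<alpha> \<le> 1/2\<close> enters: for a base in [0, 1], lowering
      the exponent from 1 to \<open>2 * \<alpha>\<close> does not decrease the power.\<close>
    have "c \<le> c powr (2 * \<alpha>)"
      using powr_mono'[of "2 * \<alpha>" 1 c] that assms by simp
    also have "c powr (2 * \<alpha>) = (c\<^sup>2) powr \<alpha>"
      using that by (cases "c = 0") (simp_all add: powr_powr flip: powr_numeral)
    finally have "c * G x \<le> (c\<^sup>2) powr \<alpha> * G x"
      by (rule mult_right_mono) (simp add: G_def)
    also have "\<dots> = (2 * (c\<^sup>2 * ln (cosh x))) powr \<alpha>"
      using cosh_real_ge_1[of x] by (simp add: G_def powr_mult ac_simps)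
    also have "\<dots> \<le> G (c * x)"
      unfolding G_def using ln_cosh_scale[OF that] assms cosh_real_ge_1[of x]
      by (intro powr_mono2) auto
    finally show ?thesis .
  qed
  have st: "0 < s + t" using assms False by simp
  have "G (s + t) = s / (s + t) * G (s + t) + t / (s + t) * G (s + t)"
    using False by (simp flip: distrib_right add_divide_distrib)
  also have "\<dots> \<le> G (s / (s + t) * (s + t)) + G (t / (s + t) * (s + t))"
    using assms st by (intro add_mono scale) (auto simp: field_simps)
  finally show ?thesis using False by (simp add: G_def)
qed

section \<open>Hyperbolic geometry of the upper half-plane\<close>

text \<open>Half the hyperbolic distance of the upper half-plane.\<close>

definition half_dist :: "complex \<Rightarrow> complex \<Rightarrow> real" where
  "half_dist z w = arsinh (cmod (z - w) / (2 * sqrt (Im z * Im w)))"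

lemma cmod_diff_cnj_sq: "(cmod (z - cnj w))\<^sup>2 = (cmod (z - w))\<^sup>2 + 4 * Im z * Im w"
  unfolding cmod_power2 by (simp add: algebra_simps power2_eq_square)

text \<open>Follows from cosh^2 = 1 + sinh^2 and \<open>cmod_diff_cnj_sq\<close>. It ties the closed
  form of the divergence to hyperbolic distance.\<close>

lemma cosh_half_dist:
  assumes "0 < Im z" "0 < Im w"
  shows "cosh (half_dist z w) = cmod (z - cnj w) / (2 * sqrt (Im z * Im w))"
proof -
  have "(cosh (half_dist z w))\<^sup>2 = (cmod (z - w))\<^sup>2 / (4 * (Im z * Im w)) + 1"
    using assms by (simp add: half_dist_def cosh_square_eq power_divide power_mult_distrib)
  also have "\<dots> = (cmod (z - cnj w) / (2 * sqrt (Im z * Im w)))\<^sup>2"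
    using assms by (simp add: cmod_diff_cnj_sq power_divide power_mult_distrib field_simps)
  finally show ?thesis
    using assms by (subst (asm) power2_eq_iff_nonneg) auto
qed

lemma half_dist_nonneg: "0 < Im z \<Longrightarrow> 0 < Im w \<Longrightarrow> 0 \<le> half_dist z w"
  by (subst sinh_real_nonneg_iff[symmetric]) (simp add: half_dist_def)

text \<open>Since sinh is strictly increasing, it suffices to compare values of sinh. Dividing
  Ptolemy's inequality by the product of the two normalising factors turns its right-hand side into
  the addition formula for sinh.\<close>

lemma half_dist_triangle:
  assumes "0 < Im x" "0 < Im y" "0 < Im z"
  shows "half_dist x z \<le> half_dist x y + half_dist y z"
proof -
  \<comment> \<open>Ptolemy's inequality for the points \<open>x\<close>, \<open>y\<close>, \<open>z\<close>, \<open>cnj y\<close>\<close>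
  have "(y - cnj y) * (x - z) = (x - y) * (z - cnj y) + (x - cnj y) * (y - z)"
    by (simp add: algebra_simps)
  then have "cmod (y - cnj y) * cmod (x - z)
      \<le> cmod (x - y) * cmod (z - cnj y) + cmod (x - cnj y) * cmod (y - z)"
    by (metis norm_mult norm_triangle_ineq)
  moreover have "cmod (y - cnj y) = 2 * Im y"
    using assms by (simp add: complex_diff_cnj norm_mult)
  moreover have "cmod (z - cnj y) = cmod (y - cnj z)"
    by (metis complex_cnj_cnj complex_cnj_diff complex_mod_cnj norm_minus_commute)
  ultimately have *: "2 * Im y * cmod (x - z)
      \<le> cmod (x - y) * cmod (y - cnj z) + cmod (x - cnj y) * cmod (y - z)"
    by simp
  have "sinh (half_dist x z) = 2 * Im y * cmod (x - z) / (4 * Im y * sqrt (Im x * Im z))"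
    using assms by (simp add: half_dist_def)
  also have "\<dots> \<le> (cmod (x - y) * cmod (y - cnj z) + cmod (x - cnj y) * cmod (y - z))
      / (4 * Im y * sqrt (Im x * Im z))"
    using assms by (intro divide_right_mono *) auto
  also have "4 * Im y * sqrt (Im x * Im z) = (2 * sqrt (Im x * Im y)) * (2 * sqrt (Im y * Im z))"
    using assms by (simp add: real_sqrt_mult)
  also have "(cmod (x - y) * cmod (y - cnj z) + cmod (x - cnj y) * cmod (y - z)) / \<dots>
      = sinh (half_dist x y + half_dist y z)"
    using assms unfolding sinh_add cosh_half_dist[OF assms(1,2)] cosh_half_dist[OF assms(2,3)]
    by (simp add: half_dist_def add_divide_distrib)
  finally show ?thesis by simp
qed

section \<open>Mean value property of the logarithm on a circle\<close>

text \<open>Factoring out \<open>B\<close> leaves \<open>Ln (1 - w * u)\<close> with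
  \<open>cmod w < 1\<close>, which is holomorphic in the unit disc and 0 at the centre. Cauchy's
  integral formula makes its circle mean vanish, so only the constant from \<open>B\<close>
  remains.\<close>

lemma has_integral_ln_cmod_circle:
  assumes "cmod A < cmod B"
  shows "((\<lambda>t. ln ((cmod (B - A * cis t))\<^sup>2)) has_integral
    2 * pi * ln ((cmod B)\<^sup>2)) {0..2 * pi}"
proof -
  define w where "w = A / B"
  have B: "B \<noteq> 0" using assms by auto
  have w: "cmod w < 1" using assms B by (simp add: w_def norm_divide)
  \<comment> \<open>A positive real part keeps the argument of \<open>Ln\<close> off the branch
    cut.\<close>
  have re: "0 < Re (1 - w * z)" if "cmod z \<le> 1" for z
  proof -
    have "Re (w * z) \<le> cmod w * cmod z"
      using complex_Re_le_cmod[of "w * z"] by (simp add: norm_mult)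
    also have "\<dots> \<le> cmod w" using that by (simp add: mult_left_le)
    finally show ?thesis using w by simp
  qed
  then have slit: "1 - w * z \<notin> \<real>\<^sub>\<le>\<^sub>0" if "cmod z \<le> 1" for z
    using that by (meson complex_nonpos_Reals_iff not_le)
  have "((\<lambda>u. Ln (1 - w * u) / (u - 0)) has_contour_integral
      2 * of_real pi * \<i> * Ln (1 - w * 0)) (circlepath 0 1)"
    by (rule Cauchy_integral_circlepath)
       (use slit in \<open>auto intro!: continuous_intros holomorphic_intros\<close>)
  then have "((\<lambda>t. Ln (1 - w * cis t) / cis t * \<i> * cis t) has_integral 0) {0..2 * pi}"
    by (simp add: circlepath_def has_contour_integral_part_circlepath_iff)
  then have "((\<lambda>t. \<i> * Ln (1 - w * cis t)) has_integral 0) {0..2 * pi}"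
    by (rule has_integral_eq[rotated]) simp
  \<comment> \<open>The imaginary part of \<open>\<i> * Ln v\<close> is \<open>Re (Ln v)\<close>,
    the logarithm of the modulus.\<close>
  from has_integral_linear[OF this bounded_linear_Im]
  have "((\<lambda>t. Re (Ln (1 - w * cis t))) has_integral 0) {0..2 * pi}"
    by (simp add: o_def)
  from has_integral_add[OF has_integral_mult_right[OF this, of 2]
      has_integral_const_real[of "ln ((cmod B)\<^sup>2)" 0 "2 * pi"]]
  have "((\<lambda>t. 2 * Re (Ln (1 - w * cis t)) + ln ((cmod B)\<^sup>2)) has_integral
      2 * pi * ln ((cmod B)\<^sup>2)) {0..2 * pi}"
    by simp
  then show ?thesis
  proof (rule has_integral_eq[rotated])
    fix t
    have nz: "1 - w * cis t \<noteq> 0"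
      using re[of "cis t"] by (metis less_irrefl norm_cis order_refl zero_complex.sel(1))
    have "cmod (B - A * cis t) = cmod B * cmod (1 - w * cis t)"
      using B by (simp add: w_def algebra_simps flip: norm_mult)
    then show "2 * Re (Ln (1 - w * cis t)) + ln ((cmod B)\<^sup>2) = ln ((cmod (B - A * cis t))\<^sup>2)"
      using nz B by (simp add: ln_mult ln_realpow power_mult_distrib)
  qed
qed

section \<open>Necessity of the bound on the exponent\<close>

text \<open>Dividing by the power of \<open>ln (cosh t)\<close> bounds a power of a quotient by 2.
  The quotient tends to 4, as \<open>ln (cosh t)\<close> behaves like t^2 / 2 near 0, so
  \<open>4 powr \<alpha> \<le> 2\<close>.\<close>

lemma ln_cosh_powr_doubling_imp_le_half:
  fixes \<alpha> :: real
  assumes "0 < \<alpha>"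
    and le: "\<And>t. 0 < t \<Longrightarrow> (2 * ln (cosh (2 * t))) powr \<alpha> 
      \<le> 2 * (2 * ln (cosh t)) powr \<alpha>"
  shows "\<alpha> \<le> 1/2"
proof -
  have "((\<lambda>t::real. ln (cosh (2 * t)) / ln (cosh t)) \<longlongrightarrow> 4) (at_right 0)"
    unfolding cosh_def scaleR_conv_of_real by real_asymp
  then have "((\<lambda>t::real. (ln (cosh (2 * t)) / ln (cosh t)) powr \<alpha>) \<longlongrightarrow> 4 powr \<alpha>) (at_right 0)"
    by (intro tendsto_intros) auto
  moreover have "\<forall>\<^sub>F t in at_right (0::real). (ln (cosh (2 * t)) / ln (cosh t)) powr \<alpha> \<le> 2"
    using eventually_at_right_less
  proof eventually_elim
    case (elim t)
    have "1 < cosh t" "1 < cosh (2 * t)" 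
      using elim cosh_real_ge_1[of t] cosh_real_ge_1[of "2 * t"] by (auto simp: less_le)
    then have pos: "0 < ln (cosh t)" "0 < ln (cosh (2 * t))" by simp_all
    then have "ln (cosh (2 * t)) powr \<alpha> \<le> 2 * ln (cosh t) powr \<alpha>"
      using le[OF elim] by (simp add: powr_mult)
    moreover have "0 < ln (cosh t) powr \<alpha>" using elim by simp
    ultimately show ?case
      using pos by (simp only: powr_divide pos_divide_le_eq less_imp_le)
  qed
  ultimately have "4 powr \<alpha> \<le> (2::real)"
    by (rule tendsto_upperbound) simp
  then have "(2::real) powr (2 * \<alpha>) \<le> 2 powr 1"
    by (simp flip: powr_powr)
  then show ?thesis by (subst (asm) powr_le_cancel_iff) auto
qed

section \<open>Closed form of the divergence\<close>

lemma cauchy_density_tan: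
  assumes "0 < Im z" "cos s \<noteq> 0"
  shows "cauchy_density z (Re z + Im z * tan s) = (cos s)\<^sup>2 / (pi * Im z)"
proof -
  have "(cmod (complex_of_real (Re z + Im z * tan s) - z))\<^sup>2 = (Im z)\<^sup>2 * (1 + (tan s)\<^sup>2)"
    by (simp add: cmod_power2 algebra_simps)
  also have "\<dots> = (Im z)\<^sup>2 / (cos s)\<^sup>2"
    using assms by (simp add: tan_sec field_simps)
  finally have "cauchy_density z (Re z + Im z * tan s) = Im z / (pi * ((Im z)\<^sup>2 / (cos s)\<^sup>2))"
    by (simp only: cauchy_density_def)
  then show ?thesis
    using assms by (simp add: field_simps power2_eq_square)
qed

text \<open>The complex number on the right factors as
  \<open>2 * cis s * cos s * (x - cnj w)\<close>. As \<open>x\<close> is real, conjugating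
  \<open>w\<close> does not change the last modulus, and the factor \<open>(cos s)\<^sup>2\<close>
  is the one in the density of \<open>z\<close>.\<close>

lemma cauchy_density_ratio_tan:
  assumes "0 < Im z" "0 < Im w" "cos s \<noteq> 0"
  defines "x \<equiv> Re z + Im z * tan s"
  shows "cauchy_density z x / cauchy_density w x
    = (cmod ((z - cnj w) + cnj (z - w) * cis (2 * s)))\<^sup>2 / (4 * Im z * Im w)"
proof -
  have "(z - cnj w) + cnj (z - w) * cis (2 * s)
      = 2 * cis s * (of_real (cos s) * (of_real x - cnj w))"
  proof -
    have cis: "cis (2 * s) = Complex (1 - 2 * (sin s)\<^sup>2) (2 * sin s * cos s)"
      by (simp add: complex_eq_iff cos_double_sin sin_double)
    have x: "of_real (cos s) * (of_real x - cnj w)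
        = of_real (Re z * cos s + Im z * sin s) - of_real (cos s) * cnj w"
      using assms(3) by (simp add: complex_eq_iff x_def tan_def field_simps)
    have 1: "(cos s)\<^sup>2 = 1 - (sin s)\<^sup>2" by (simp add: cos_squared_eq)
    show ?thesis
      unfolding cis x
      \<comment> \<open>Componentwise this is a polynomial identity in \<open>sin s\<close> and
        \<open>cos s\<close> modulo fact 1.\<close>
      by (rule complex_eqI; simp; use 1 in algebra)
  qed
  moreover have "cmod (of_real x - cnj w) = cmod (of_real x - w)"
    by (metis complex_cnj_complex_of_real complex_cnj_diff complex_mod_cnj)
  ultimately have "(cmod ((z - cnj w) + cnj (z - w) * cis (2 * s)))\<^sup>2
      = 4 * (cos s)\<^sup>2 * (cmod (of_real x - w))\<^sup>2"
    by (simp add: norm_mult power_mult_distrib)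
  moreover have "cauchy_density z x = (cos s)\<^sup>2 / (pi * Im z)"
    unfolding x_def using assms by (intro cauchy_density_tan)
  ultimately show ?thesis
    using assms(1,2) by (simp add: cauchy_density_def[of w])
qed

lemma cauchy_density_measurable [measurable]: "cauchy_density z \<in> borel_measurable borel"
  unfolding cauchy_density_def by measurable

lemma cmod_diff_less_cmod_diff_cnj:
  assumes "0 < Im z" "0 < Im w"
  shows "cmod (z - w) < cmod (z - cnj w)"
proof (rule power2_less_imp_less)
  show "(cmod (z - w))\<^sup>2 < (cmod (z - cnj w))\<^sup>2"
    using assms by (simp add: cmod_diff_cnj_sq)
qed simp

lemma range_tan_substitution:
  fixes a b :: real
  assumes "0 < b"
  shows "(\<lambda>t. a + b * tan ((t - pi) / 2)) ` {0<..<2 * pi} = UNIV"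
proof -
  have "x \<in> (\<lambda>t. a + b * tan ((t - pi) / 2)) ` {0<..<2 * pi}" for x
  proof (rule image_eqI)
    show "x = a + b * tan ((2 * arctan ((x - a) / b) + pi - pi) / 2)"
      using assms by (simp add: tan_arctan)
    show "2 * arctan ((x - a) / b) + pi \<in> {0<..<2 * pi}"
      using arctan[of "(x - a) / b"] by simp
  qed
  then show ?thesis by blast
qed

lemma inj_on_tan_substitution:
  fixes a b :: real
  assumes "0 < b"
  shows "inj_on (\<lambda>t. a + b * tan ((t - pi) / 2)) {0<..<2 * pi}"
proof (rule inj_onI)
  fix s t :: real
  assume s: "s \<in> {0<..<2 * pi}" and t: "t \<in> {0<..<2 * pi}"
    and "a + b * tan ((s - pi) / 2) = a + b * tan ((t - pi) / 2)"
  then have "arctan (tan ((s - pi) / 2)) = arctan (tan ((t - pi) / 2))"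
    using assms by simp
  with s t show "s = t"
    by (subst (asm) (1 2) arctan_tan) (auto simp: field_simps)
qed

text \<open>After the substitution \<open>g\<close>, the density of \<open>z\<close> times the
  Jacobian \<open>g'\<close> is the constant 1 / (2 pi), so the integrand becomes \<open>h\<close>,
  whose integral the mean value property supplies.\<close>

lemma KL_div_cauchy:
  assumes z: "0 < Im z" and w: "0 < Im w"
  shows "KL_div (cauchy_density z) (cauchy_density w)
    = ln ((cmod (z - cnj w))\<^sup>2 / (4 * Im z * Im w))"
proof -
  define f where "f x = cauchy_density z x * ln (cauchy_density z x / cauchy_density w x)" for x
  define g where "g t = Re z + Im z * tan ((t - pi) / 2)" for t
  define g' where "g' t = Im z / (2 * (cos ((t - pi) / 2))\<^sup>2)" for t
  define S where "S = {0<..<2 * pi}"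
  define h where "h t = (ln ((cmod ((z - cnj w) - cnj (z - w) * cis t))\<^sup>2)
    - ln (4 * Im z * Im w)) / (2 * pi)" for t
  define K where "K = ln ((cmod (z - cnj w))\<^sup>2 / (4 * Im z * Im w))"
  have less: "cmod (cnj (z - w)) < cmod (z - cnj w)"
    using cmod_diff_less_cmod_diff_cnj[OF z w] by (simp del: complex_cnj_diff)
  have ne: "(z - cnj w) - cnj (z - w) * cis t \<noteq> 0" for t
  proof
    assume "(z - cnj w) - cnj (z - w) * cis t = 0"
    then have "cmod (z - cnj w) = cmod (cnj (z - w) * cis t)" by simp
    with less show False by (simp add: norm_mult)
  qed
  have cos_ne: "cos ((t - pi) / 2) \<noteq> 0" if "t \<in> S" for t
    using that cos_gt_zero_pi[of "(t - pi) / 2"] by (simp add: S_def)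
  have deriv: "(g has_field_derivative g' t) (at t within S)" if "t \<in> S" for t
    unfolding g_def g'_def using cos_ne[OF that]
    by (auto intro!: derivative_eq_intros simp: field_simps)
  have subst: "\<bar>g' t\<bar> * f (g t) = h t" if "t \<in> S" for t
  proof -
    \<comment> \<open>The shift by \<open>pi\<close> lets \<open>t\<close> run over (0, 2 pi) and
      turns the plus sign of \<open>cauchy_density_ratio_tan\<close> into a minus.\<close>
    have "cis (2 * ((t - pi) / 2)) = - cis t"
      by (simp add: complex_eq_iff diff_divide_distrib)
    then have "cauchy_density z (g t) / cauchy_density w (g t)
        = (cmod ((z - cnj w) - cnj (z - w) * cis t))\<^sup>2 / (4 * Im z * Im w)"
      unfolding g_def using cauchy_density_ratio_tan[OF z w cos_ne[OF that]] by simp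
    moreover have "cauchy_density z (g t) = (cos ((t - pi) / 2))\<^sup>2 / (pi * Im z)"
      unfolding g_def by (rule cauchy_density_tan[OF z cos_ne[OF that]])
    ultimately show ?thesis
      using cos_ne[OF that] z w ne[of t]
      by (simp add: f_def g'_def h_def ln_div del: complex_cnj_diff)
  qed
  have "(h has_integral (2 * pi * ln ((cmod (z - cnj w))\<^sup>2)
      - 2 * pi * ln (4 * Im z * Im w)) / (2 * pi))
      {0..2 * pi}"
    unfolding h_def using has_integral_const_real[of "ln (4 * Im z * Im w)" 0 "2 * pi"]
    by (intro has_integral_divide has_integral_diff has_integral_ln_cmod_circle less) simp
  moreover have "(2 * pi * ln ((cmod (z - cnj w))\<^sup>2)
      - 2 * pi * ln (4 * Im z * Im w)) / (2 * pi) = K"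
    using z w less by (subst K_def, subst ln_div) (auto simp: field_simps)
  ultimately have "(h has_integral K) S"
    by (simp add: S_def has_integral_Icc_iff_Ioo)
  \<comment> \<open>\<open>h\<close> extends continuously to the endpoints, where \<open>g\<close>
    has its poles; this yields absolute integrability on \<open>S\<close>.\<close>
  moreover have "continuous_on {0..2 * pi} h"
    unfolding h_def using ne by (intro continuous_intros) auto
  then have "h absolutely_integrable_on {0..2 * pi}"
    by (rule absolutely_integrable_continuous_real)
  then have "h absolutely_integrable_on S"
    by (rule set_integrable_subset) (auto simp: S_def)
  ultimately have "(\<lambda>t. \<bar>g' t\<bar> * f (g t)) absolutely_integrable_on S \<and>
      integral S (\<lambda>t. \<bar>g' t\<bar> * f (g t)) = K"
    using subst by (auto simp: integral_unique cong: integral_cong set_integrable_cong)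
  \<comment> \<open>The change of variables is an equivalence, so integrability of \<open>f\<close>
    is obtained along with the value.\<close>
  then have "f absolutely_integrable_on (g ` S) \<and> integral (g ` S) f = K"
    using has_absolute_integral_change_of_variables_1'[of S g g' f K] deriv
      inj_on_tan_substitution[OF z, of "Re z"] by (simp add: S_def g_def[abs_def])
  moreover have "g ` S = UNIV"
    unfolding g_def S_def by (rule range_tan_substitution[OF z])
  ultimately have *: "integrable lebesgue f" "integral UNIV f = K"
    by (simp_all add: set_integrable_def)
  \<comment> \<open>Borel measurability carries integrability from the completed measure back to
    \<open>lborel\<close>.\<close>
  moreover have "f \<in> borel_measurable lborel"
    unfolding f_def[abs_def] by measurable
  ultimately have "integrable lborel f"
    using integrable_completion by blast
  then show ?thesis
    using integral_lborel[of f] *(2) by (simp add: KL_div_def f_def[abs_def] K_def)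
qed

lemma KL_div_cauchy_half_dist:
  assumes "0 < Im z" "0 < Im w"
  shows "KL_div (cauchy_density z) (cauchy_density w) = 2 * ln (cosh (half_dist z w))"
proof -
  have "(cmod (z - cnj w))\<^sup>2 / (4 * Im z * Im w) = (cosh (half_dist z w))\<^sup>2"
    using assms by (simp add: cosh_half_dist power_divide power_mult_distrib)
  then show ?thesis
    using assms by (simp add: KL_div_cauchy ln_realpow)
qed

section \<open>Points on a geodesic, and the characterisation of the metric exponents\<close>

text \<open>Supplies equidistant points on a geodesic: the exponent \<open>2 * s\<close> makes
  \<open>s\<close> a unit-speed parameter for \<open>half_dist\<close> on the imaginary
  axis.\<close>

lemma half_dist_imaginary_axis:
  fixes s t :: real
  shows "half_dist (Complex 0 (exp (2 * s))) (Complex 0 (exp (2 * t))) = \<bar>s - t\<bar>"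
proof -
  have "cmod (Complex 0 (exp (2 * s)) - Complex 0 (exp (2 * t)))
      = \<bar>exp (2 * s) - exp (2 * t)\<bar>"
    by (simp add: cmod_def)
  also have "\<dots> = \<bar>2 * (exp (s + t) * sinh (s - t))\<bar>"
    by (simp add: sinh_def algebra_simps flip: exp_add)
  also have "\<dots> = 2 * exp (s + t) * sinh \<bar>s - t\<bar>"
    by (simp add: abs_mult)
  finally have 1: "cmod (Complex 0 (exp (2 * s)) - Complex 0 (exp (2 * t)))
      = 2 * exp (s + t) * sinh \<bar>s - t\<bar>" .
  have "exp (2 * s) * exp (2 * t) = (exp (s + t))\<^sup>2"
    by (simp add: algebra_simps flip: exp_add exp_double)
  then have 2: "sqrt (exp (2 * s) * exp (2 * t)) = exp (s + t)" by simp
  show ?thesis by (simp only: half_dist_def 1 complex.sel 2)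
      (simp add: arsinh_sinh_real del: sinh_real_abs)
qed

theorem theorem8:
  fixes \<alpha> :: real
  assumes "0 < \<alpha>" and "\<alpha> \<le> 1"
  shows "metric_on upper_half_plane
           (\<lambda>\<theta>\<^sub>1 \<theta>\<^sub>2. KL_div (cauchy_density \<theta>\<^sub>1) (cauchy_density \<theta>\<^sub>2) powr \<alpha>)
         \<longleftrightarrow> 0 < \<alpha> \<and> \<alpha> \<le> 1 / 2"
proof -
  define D where "D z w = (2 * ln (cosh (half_dist z w))) powr \<alpha>" for z w
  have KL: "KL_div (cauchy_density z) (cauchy_density w) powr \<alpha> = D z w"
    if "0 < Im z" "0 < Im w" for z w
    using that by (simp add: D_def KL_div_cauchy_half_dist)
  have zero: "D z w = 0 \<longleftrightarrow> z = w" if "0 < Im z" "0 < Im w" for z w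
    using that by (simp add: D_def half_dist_def)
  have sym: "D z w = D w z" for z w
    by (simp add: D_def half_dist_def norm_minus_commute mult.commute)
  have nonneg: "0 \<le> D z w" for z w
    by (simp add: D_def)
  \<comment> \<open>The other metric axioms hold whatever the exponent, so only the triangle
    inequality remains.\<close>
  have "metric_on upper_half_plane
           (\<lambda>z w. KL_div (cauchy_density z) (cauchy_density w) powr \<alpha>) \<longleftrightarrow>
      (\<forall>x y z. 0 < Im x \<and> 0 < Im y \<and> 0 < Im z \<longrightarrow> D x z \<le> D x y + D y z)"
    unfolding metric_on_iff upper_half_plane_def using sym zero nonneg
    by (auto simp: KL)
  also have "\<dots> \<longleftrightarrow> \<alpha> \<le> 1 / 2"
  proof
    assume triangle: "\<forall>x y z. 0 < Im x \<and> 0 < Im y \<and> 0 < Im z \<longrightarrow> D x z \<le> D x y + D y z"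
    show "\<alpha> \<le> 1 / 2"
    proof (rule ln_cosh_powr_doubling_imp_le_half[OF assms(1)])
      fix t :: real assume "0 < t"
      define p where "p s = Complex 0 (exp (2 * s))" for s
      have D: "D (p r) (p s) = (2 * ln (cosh (r - s))) powr \<alpha>" for r s
        by (simp add: D_def p_def half_dist_imaginary_axis)
      \<comment> \<open>The middle point \<open>p t\<close> is the midpoint, so both terms on the
        right coincide.\<close>
      have "D (p (2 * t)) (p 0) \<le> D (p (2 * t)) (p t) + D (p t) (p 0)"
        using triangle by (simp add: p_def)
      then show "(2 * ln (cosh (2 * t))) powr \<alpha> \<le> 2 * (2 * ln (cosh t)) powr \<alpha>"
        unfolding D by simp
    qed
  next
    assume \<alpha>: "\<alpha> \<le> 1 / 2"
    show "\<forall>x y z. 0 < Im x \<and> 0 < Im y \<and> 0 < Im z \<longrightarrow> D x z \<le> D x y + D y z"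
    proof (intro allI impI; elim conjE)
      fix x y z assume xyz: "0 < Im x" "0 < Im y" "0 < Im z"
      have "D x z \<le> (2 * ln (cosh (half_dist x y + half_dist y z))) powr \<alpha>"
        unfolding D_def
        using half_dist_triangle[OF xyz] half_dist_nonneg xyz assms cosh_real_ge_1
        by (intro powr_mono2 mult_left_mono) (auto simp: cosh_real_nonneg_le_iff)
      also have "\<dots> \<le> D x y + D y z"
        unfolding D_def using half_dist_nonneg xyz assms \<alpha>
        by (intro powr_ln_cosh_subadditive) auto
      finally show "D x z \<le> D x y + D y z" .
    qed
  qed
  finally show ?thesis using assms(1) by simp
qed

end
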